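(* Let $k_4$ be the morphism $\texttt{0}\mapsto\texttt{1232}$, $\texttt{1}\mapsto\texttt{12}$, $\texttt{2}\mapsto\texttt{10}$ and $k_3$ the morphism $\texttt{0}\mapsto\texttt{122}$, $\texttt{1}\mapsto\texttt{12}$, $\texttt{2}\mapsto\texttt{10}$. Then: (1) every bi-infinite overlap-free walk on $P_4$ has the same set of finite factors as $k_4(b_3)$; (2) every bi-infinite overlap-free walk on $P_3^\star$ has the same set of finite factors as $k_3(b_3)$.
   Context: $P_4$ is the undirected path with vertices $\texttt{0},\texttt{1},\texttt{2},\texttt{3}$ and edges $\texttt{01},\texttt{12},\texttt{23}$. $P_3^\star$ is the undirected path with vertices $\texttt{0},\texttt{1},\texttt{2}$ and edges $\texttt{01},\texttt{12}$, together with a loop at $\texttt{2}$. A walk on a graph is a word over its vertex set in which any two consecutive letters are joined by an edge (or loop). A word is overlap-free if it contains no factor $u^nv$ with $u$ nonempty, $v$ a prefix of $u$, and exponent $|u^nv|/|u|>2$. $b_3$ is the Hall–Thue word, the fixed point starting with $\texttt{0}$ of the morphism $\texttt{0}\mapsto\texttt{012}$, $\texttt{1}\mapsto\texttt{02}$, $\texttt{2}\mapsto\texttt{1}$. *)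

theory Defs
  imports Complex_Main "HOL-Library.Sublist"
begin

text \<open>
  Finite words are lists, right-infinite words are functions on \<open>nat\<close>, and bi-infinite words are
  functions on \<open>int\<close>. Letters are natural numbers.
\<close>

definition factors :: "(nat \<Rightarrow> 'a) \<Rightarrow> 'a list set" where
  "factors x = {map x [i..<j] | i j. True}"

definition bi_factors :: "(int \<Rightarrow> 'a) \<Rightarrow> 'a list set" where
  "bi_factors w = {map w [i..j] | i j. True}"

definition is_overlap :: "'a list \<Rightarrow> bool" where
  "is_overlap x \<longleftrightarrow>
     (\<exists>u n v. u \<noteq> [] \<and> prefix v u \<and> x = concat (replicate n u) @ v \<and>
        real (length x) / real (length u) > 2)"

definition bi_overlap_free :: "(int \<Rightarrow> 'a) \<Rightarrow> bool" where
  "bi_overlap_free w \<longleftrightarrow> \<not> (\<exists>x \<in> bi_factors w. is_overlap x)"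


text \<open>
  An undirected graph is given by its vertex set \<open>V\<close> and its set \<open>E\<close> of edges; an edge is the set of
  its endpoints, so that a loop at \<open>a\<close> is the singleton \<open>{a}\<close>.
\<close>

definition bi_walk :: "'a set \<Rightarrow> 'a set set \<Rightarrow> (int \<Rightarrow> 'a) \<Rightarrow> bool" where
  "bi_walk V E w \<longleftrightarrow> (\<forall>i. w i \<in> V) \<and> (\<forall>i. {w i, w (i + 1)} \<in> E)"

definition P4_verts :: "nat set" where
  "P4_verts = {0, 1, 2, 3}"

definition P4_edges :: "nat set set" where
  "P4_edges = {{0, 1}, {1, 2}, {2, 3}}"

definition P3_star_verts :: "nat set" where
  "P3_star_verts = {0, 1, 2}"

definition P3_star_edges :: "nat set set" where
  "P3_star_edges = {{0, 1}, {1, 2}, {2}}"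


text \<open>
  A morphism is given by the images of the letters; \<open>word_image f\<close> is its extension to finite words.
  For a morphism that erases no letter of \<open>x\<close>, the first \<open>i + 1\<close> letters of \<open>x\<close> already
  determine the letter at position \<open>i\<close> of the image of \<open>x\<close>; \<open>inf_image\<close> is meant for such
  morphisms only, and \<open>inf_image_prefix\<close> below shows that it is then the extension to infinite words.
\<close>

definition word_image :: "('a \<Rightarrow> 'b list) \<Rightarrow> 'a list \<Rightarrow> 'b list" where
  "word_image f xs = concat (map f xs)"

definition inf_image :: "('a \<Rightarrow> 'b list) \<Rightarrow> (nat \<Rightarrow> 'a) \<Rightarrow> nat \<Rightarrow> 'b" where
  "inf_image f x i = word_image f (map x [0..<Suc i]) ! i"

text \<open>The following are morphisms on words over \<open>{0, 1, 2}\<close>; other letters never occur.\<close>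

definition hall_thue :: "nat \<Rightarrow> nat list" where
  "hall_thue a =
     (if a = 0 then [0, 1, 2] else if a = 1 then [0, 2] else if a = 2 then [1] else [])"

definition k4 :: "nat \<Rightarrow> nat list" where
  "k4 a = (if a = 0 then [1, 2, 3, 2] else if a = 1 then [1, 2] else if a = 2 then [1, 0] else [])"

definition k3 :: "nat \<Rightarrow> nat list" where
  "k3 a = (if a = 0 then [1, 2, 2] else if a = 1 then [1, 2] else if a = 2 then [1, 0] else [])"

text \<open>Existence and uniqueness of the fixed point are proved in \<open>ex1_b3\<close> below.\<close>

definition b3 :: "nat \<Rightarrow> nat" where
  "b3 = (THE x. range x \<subseteq> {0, 1, 2} \<and> x 0 = 0 \<and> inf_image hall_thue x = x)"


lemma word_image_Nil [simp]: "word_image f [] = []"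
  and word_image_Cons [simp]: "word_image f (a # xs) = f a @ word_image f xs"
  and word_image_append [simp]: "word_image f (xs @ ys) = word_image f xs @ word_image f ys"
  by (simp_all add: word_image_def)

lemma word_image_mono_prefix: "prefix xs ys \<Longrightarrow> prefix (word_image f xs) (word_image f ys)"
  by (auto simp: prefix_def)

lemma prefix_nth: "prefix xs ys \<Longrightarrow> i < length xs \<Longrightarrow> ys ! i = xs ! i"
  by (auto simp: prefix_def nth_append)

lemma length_word_image_ge:
  assumes "\<And>a. a \<in> set xs \<Longrightarrow> f a \<noteq> []"
  shows "length xs \<le> length (word_image f xs)"
  using assms
proof (induction xs)
  case (Cons a xs)
  have "f a \<noteq> []" "length xs \<le> length (word_image f xs)"
    using Cons by auto
  then show ?case
    by (cases "f a") auto
qed simp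

lemma prefix_map_upt: "m \<le> n \<Longrightarrow> prefix (map x [0..<m]) (map x [0..<n])"
  by (metis le_add_diff_inverse map_append prefixI upt_add_eq_append zero_le)

lemma inf_image_prefix:
  assumes nonerasing: "\<And>i. f (x i) \<noteq> []"
  shows "map (inf_image f x) [0..<length (word_image f (map x [0..<n]))] =
           word_image f (map x [0..<n])"
proof (rule nth_equalityI)
  fix i
  let ?u = "word_image f (map x [0..<n])" and ?v = "word_image f (map x [0..<Suc i])"
  assume "i < length (map (inf_image f x) [0..<length ?u])"
  then have i: "i < length ?u"
    by simp
  have "length (map x [0..<Suc i]) \<le> length ?v"
    by (rule length_word_image_ge) (use nonerasing in auto)
  then have i': "i < length ?v"
    by simp
  have "prefix ?u ?v \<or> prefix ?v ?u"
    by (metis nle_le prefix_map_upt word_image_mono_prefix)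
  then have "?v ! i = ?u ! i"
    using i i' prefix_nth by metis
  then show "map (inf_image f x) [0..<length ?u] ! i = ?u ! i"
    using i by (simp add: inf_image_def)
qed simp

lemma hall_thue_nonempty: "a \<in> {0, 1, 2} \<Longrightarrow> hall_thue a \<noteq> []"
  by (auto simp: hall_thue_def)

lemma length_hall_thue_gt:
  assumes "set xs \<subseteq> {0, 1, 2}" "xs \<noteq> []" "hd xs = 0"
  shows "length xs < length (word_image hall_thue xs)"
proof -
  obtain ys where xs: "xs = 0 # ys"
    using assms by (cases xs) auto
  have "length ys \<le> length (word_image hall_thue ys)"
    by (rule length_word_image_ge) (use assms xs hall_thue_nonempty in auto)
  then show ?thesis
    by (simp add: xs hall_thue_def)
qed

lemma ex1_b3: "\<exists>!x. range x \<subseteq> {0, 1, 2} \<and> x 0 = 0 \<and> inf_image hall_thue x = x"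
proof -
  define P where "P n = (word_image hall_thue ^^ n) [0]" for n
  have P_Suc: "P (Suc n) = word_image hall_thue (P n)" for n
    by (simp add: P_def)
  have P_0: "P 0 = [0]"
    by (simp add: P_def)
  have step: "prefix (P n) (P (Suc n))" for n
  proof (induction n)
    case 0
    show ?case by (simp add: P_Suc P_0 hall_thue_def)
  next
    case (Suc n)
    then show ?case by (metis P_Suc word_image_mono_prefix)
  qed
  have mono: "prefix (P m) (P n)" if "m \<le> n" for m n
    using that by (induction rule: dec_induct) (auto intro: prefix_order.trans step)
  have P_set: "set (P n) \<subseteq> {0, 1, 2}" for n
    by (induction n) (auto simp: P_0 P_Suc word_image_def hall_thue_def split: if_splits)
  have P_hd: "P n \<noteq> [] \<and> hd (P n) = 0" for n
    using mono[of 0 n] by (auto simp: P_0 prefix_def)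
  have P_length: "n < length (P n)" for n
  proof (induction n)
    case (Suc n)
    then show ?case
      using length_hall_thue_gt[OF P_set, of n] P_hd[of n] by (simp add: P_Suc)
  qed (simp add: P_0)
  define b where "b i = P i ! i" for i
  have b_nth: "P n ! i = b i" if "i < length (P n)" for n i
    unfolding b_def using that P_length[of i] mono[of n i] mono[of i n] prefix_nth
    by (metis nle_le)
  have b_range: "range b \<subseteq> {0, 1, 2}"
  proof (rule image_subsetI)
    show "b i \<in> {0, 1, 2}" for i
      using subsetD[OF P_set nth_mem[OF P_length]] unfolding b_def .
  qed
  have b_0: "b 0 = 0"
    by (simp add: b_def P_0)
  have b_fix: "inf_image hall_thue b = b"
  proof
    fix i
    let ?u = "map b [0..<Suc i]"
    have "?u = take (Suc i) (P (Suc i))"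
      using P_length[of "Suc i"] by (intro nth_equalityI) (auto simp: b_nth simp del: upt_Suc)
    then have pre: "prefix (word_image hall_thue ?u) (P (Suc (Suc i)))"
      by (metis P_Suc take_is_prefix word_image_mono_prefix)
    have "length ?u \<le> length (word_image hall_thue ?u)"
      by (rule length_word_image_ge) (use b_range hall_thue_nonempty in auto)
    then have "i < length (word_image hall_thue ?u)"
      by simp
    then have "word_image hall_thue ?u ! i = P (Suc (Suc i)) ! i"
      using prefix_nth[OF pre] by simp
    also have "\<dots> = b i"
      using P_length[of "Suc (Suc i)"] by (intro b_nth) simp
    finally show "inf_image hall_thue b i = b i"
      by (simp only: inf_image_def)
  qed
  have rec: "x i = word_image hall_thue (map x [0..<i]) ! i"
    if "range x \<subseteq> {0, 1, 2}" "x 0 = 0" "inf_image hall_thue x = x" "i > 0" for x i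
  proof -
    have "length (map x [0..<i]) < length (word_image hall_thue (map x [0..<i]))"
    proof (rule length_hall_thue_gt)
      show "set (map x [0..<i]) \<subseteq> {0, 1, 2}"
        using that(1) by (simp add: image_subset_iff)
    qed (use that in \<open>simp_all add: hd_map\<close>)
    then have "word_image hall_thue (map x [0..<Suc i]) ! i = word_image hall_thue (map x [0..<i]) ! i"
      by (simp add: nth_append)
    then show ?thesis
      using fun_cong[OF that(3), of i] by (simp only: inf_image_def)
  qed
  have unique: "x = b" if x: "range x \<subseteq> {0, 1, 2}" "x 0 = 0" "inf_image hall_thue x = x" for x
  proof
    fix i
    show "x i = b i"
    proof (induction i rule: less_induct)
      case (less i)
      show ?case
      proof (cases "i = 0")
        case False
        then have "map x [0..<i] = map b [0..<i]"
          using less by simp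
        then show ?thesis
          using rec[OF x, of i] rec[OF b_range b_0 b_fix, of i] False by (metis gr0I)
      qed (simp add: x b_0)
    qed
  qed
  show ?thesis
    by (rule ex1I[of _ b]) (simp_all only: b_range b_0 b_fix unique simp_thms)
qed

lemma b3_range: "range b3 \<subseteq> {0, 1, 2}"
  and b3_0: "b3 0 = 0"
  and b3_fixed_point: "inf_image hall_thue b3 = b3"
  using theI'[OF ex1_b3, folded b3_def] by simp_all

end

theory Submission
  imports Defs
begin

text \<open>
  Cutting an overlap-free walk before each occurrence of \<open>1\<close> leaves only the blocks \<open>k 0\<close>, \<open>k 1\<close>,
  \<open>k 2\<close>, so the walk is \<open>k(x)\<close> for a bi-infinite word \<open>x\<close>. As every block starts with \<open>1\<close>, a square
  in \<open>x\<close> gives an overlap; and \<open>k(010)\<close> contains the overlap \<open>21212\<close>, while \<open>212\<close> extends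
  to \<open>02120\<close>, whose image contains the overlap \<open>210121012\<close>. So \<open>x\<close> is square-free and avoids
  \<open>010\<close> and \<open>212\<close>. Such a word is in turn the image under the Hall--Thue morphism \<open>h\<close> of a word of
  the same kind. Iterating, each factor of \<open>x\<close> lies in some \<open>h\<^sup>n(ab)\<close> with \<open>a \<noteq> b\<close>, and all
  six words \<open>ab\<close> occur in \<open>h\<^sup>3(0)\<close>; conversely \<open>h\<^sup>n(0)\<close> occurs in \<open>x\<close> for all \<open>n\<close>.

  Bi-infinite words are only used through their sets of factors, that is, through
  factor-closed languages whose words can be extended on both sides.
\<close>

section \<open>Factor closures and morphisms\<close>

definition factor_closure :: "'a list set \<Rightarrow> 'a list set" where
  "factor_closure X = {v. \<exists>u\<in>X. sublist v u}"

lemma factor_closure_subsetI: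
  assumes "\<And>u. u \<in> X \<Longrightarrow> \<exists>v\<in>Y. sublist u v"
  shows "factor_closure X \<subseteq> factor_closure Y"
  using assms sublist_order.order.trans unfolding factor_closure_def by blast

lemma factor_closure_image:
  assumes "\<And>u v. sublist u v \<Longrightarrow> sublist (g u) (g v)"
  shows "factor_closure (g ` factor_closure X) = factor_closure (g ` X)"
proof (rule equalityI; rule factor_closure_subsetI)
  show "\<exists>v\<in>g ` X. sublist u v" if "u \<in> g ` factor_closure X" for u
    using that assms unfolding factor_closure_def by blast
  show "\<exists>v\<in>g ` factor_closure X. sublist u v" if "u \<in> g ` X" for u
    using that unfolding factor_closure_def by blast
qed

lemma sublist_append3_long_middle:
  assumes "sublist v (x @ y @ z)" "length v \<le> length y"
  shows "sublist v (x @ y) \<or> sublist v (y @ z)"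
proof -
  consider (left) "sublist v x" | (right) "sublist v (y @ z)"
    | (straddling) v1 v2 where "v = v1 @ v2" "suffix v1 x" "prefix v2 (y @ z)"
    using assms(1) by (auto simp: sublist_append)
  then show ?thesis
  proof cases
    case (straddling v1 v2)
    then have "prefix v2 y"
      using assms(2) prefix_length_prefix[of v2 "y @ z" y] by simp
    then show ?thesis
      using straddling by (auto simp: sublist_append)
  qed (auto simp: sublist_append)
qed

lemma sublist_word_image_pair:
  assumes "sublist v (word_image g u)" "\<And>a. a \<in> set u \<Longrightarrow> length v \<le> length (g a)"
  shows "\<exists>u'. length u' \<le> 2 \<and> sublist u' u \<and> sublist v (word_image g u')"
  using assms
proof (induction u)
  case (Cons a u)
  show ?case
  proof (cases u)
    case Nil
    then show ?thesis
      using Cons.prems by (intro exI[of _ "[a]"]) simp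
  next
    case u: (Cons b t)
    then consider (initial) "sublist v (g a @ g b)" | (final) "sublist v (word_image g u)"
      using Cons.prems sublist_append3_long_middle[of v "g a" "g b" "word_image g t"] by auto
    then show ?thesis
    proof cases
      case initial
      then show ?thesis
        by (intro exI[of _ "[a, b]"]) (simp add: u sublist_Cons_right)
    next
      case final
      then show ?thesis
        using Cons.IH Cons.prems(2) by (auto simp: sublist_Cons_right)
    qed
  qed
qed simp

lemma funpow_word_image_append:
  fixes f :: "'a \<Rightarrow> 'a list"
  shows "(word_image f ^^ n) (u @ v) = (word_image f ^^ n) u @ (word_image f ^^ n) v"
  by (induction n) simp_all

lemma funpow_word_image_conv_word_image:
  fixes f :: "'a \<Rightarrow> 'a list"
  shows "(word_image f ^^ n) u = word_image (\<lambda>a. (word_image f ^^ n) [a]) u"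
proof (induction u)
  case Nil
  show ?case by (induction n) simp_all
next
  case (Cons a u)
  then show ?case
    using funpow_word_image_append[of n f "[a]" u] by simp
qed

lemma sublist_funpow_word_image_pair:
  fixes f :: "'a \<Rightarrow> 'a list"
  assumes "sublist v ((word_image f ^^ n) u)"
    and "\<And>a. a \<in> set u \<Longrightarrow> length v \<le> length ((word_image f ^^ n) [a])"
  shows "\<exists>u'. length u' \<le> 2 \<and> sublist u' u \<and> sublist v ((word_image f ^^ n) u')"
  using sublist_word_image_pair[of v "\<lambda>a. (word_image f ^^ n) [a]" u] assms
  by (simp flip: funpow_word_image_conv_word_image)

lemma sublist_word_image: "sublist u v \<Longrightarrow> sublist (word_image f u) (word_image f v)"
  unfolding sublist_def by (metis word_image_append)

lemma sublist_funpow_word_image: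
  fixes f :: "'a \<Rightarrow> 'a list"
  shows "sublist u v \<Longrightarrow> sublist ((word_image f ^^ n) u) ((word_image f ^^ n) v)"
  by (induction n) (simp_all add: sublist_word_image)

section \<open>Factors of infinite words\<close>

lemma factors_eq_closure_prefixes: "factors x = factor_closure (range (\<lambda>n. map x [0..<n]))"
proof (intro equalityI subsetI)
  fix v assume "v \<in> factors x"
  then obtain i j where v: "v = map x [i..<j]"
    by (auto simp: factors_def)
  have "suffix [i..<j] [0..<j]"
    by (metis drop_upt plus_nat.add_0 suffix_drop)
  then have "sublist v (map x [0..<j])"
    by (simp add: v map_mono_sublist)
  then show "v \<in> factor_closure (range (\<lambda>n. map x [0..<n]))"
    by (auto simp: factor_closure_def)
next
  fix v assume "v \<in> factor_closure (range (\<lambda>n. map x [0..<n]))"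
  then obtain n p q where pq: "map x [0..<n] = p @ v @ q"
    by (auto simp: factor_closure_def sublist_def)
  have "length p + length v \<le> n"
    using arg_cong[OF pq, of length] by simp
  moreover have "v = take (length v) (drop (length p) (map x [0..<n]))"
    by (simp add: pq)
  ultimately have "v = map x [length p..<length p + length v]"
    by (simp add: drop_map take_map)
  then show "v \<in> factors x"
    unfolding factors_def by blast
qed

lemma factors_inf_image:
  assumes nonerasing: "\<And>i. f (x i) \<noteq> []"
  shows "factors (inf_image f x) = factor_closure (word_image f ` factors x)"
proof -
  have "factors (inf_image f x)
      = factor_closure (word_image f ` range (\<lambda>n. map x [0..<n]))"
    unfolding factors_eq_closure_prefixes
  proof (rule equalityI; rule factor_closure_subsetI)
    fix u assume "u \<in> range (\<lambda>n. map (inf_image f x) [0..<n])"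
    then obtain n where u: "u = map (inf_image f x) [0..<n]"
      by blast
    have "n \<le> length (word_image f (map x [0..<n]))"
      using length_word_image_ge[of "map x [0..<n]" f] nonerasing by auto
    then have "prefix u (word_image f (map x [0..<n]))"
      using prefix_map_upt inf_image_prefix[of f x n, OF nonerasing] by (metis u)
    then show "\<exists>v\<in>word_image f ` range (\<lambda>n. map x [0..<n]). sublist u v"
      by blast
  next
    fix u assume "u \<in> word_image f ` range (\<lambda>n. map x [0..<n])"
    then obtain n where "u = word_image f (map x [0..<n])"
      by blast
    then show "\<exists>v\<in>range (\<lambda>n. map (inf_image f x) [0..<n]). sublist u v"
      using inf_image_prefix[of f x n, OF nonerasing] by (metis rangeI sublist_order.order.refl)
  qed
  then show ?thesis
    by (simp add: factors_eq_closure_prefixes factor_closure_image sublist_word_image)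
qed

lemma funpow_word_image_fixed_point:
  fixes f :: "'a \<Rightarrow> 'a list"
  assumes "\<And>i. f (x i) \<noteq> []" "inf_image f x = x"
  shows "\<exists>m. (word_image f ^^ n) [x 0] = map x [0..<m]"
proof (induction n)
  case 0
  show ?case by (intro exI[of _ 1]) simp
next
  case (Suc n)
  then show ?case
    using inf_image_prefix[of f x] assms by (metis comp_apply funpow.simps(2))
qed

lemma factors_fixed_point:
  fixes f :: "'a \<Rightarrow> 'a list"
  assumes nonerasing: "\<And>i. f (x i) \<noteq> []" and fixed: "inf_image f x = x"
    and growth: "\<And>l. \<exists>n. l \<le> length ((word_image f ^^ n) [x 0])"
  shows "factors x = factor_closure (range (\<lambda>n. (word_image f ^^ n) [x 0]))"
proof -
  have iterate: "\<exists>m. (word_image f ^^ n) [x 0] = map x [0..<m]" for n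
    using nonerasing fixed by (rule funpow_word_image_fixed_point)
  show ?thesis
    unfolding factors_eq_closure_prefixes
  proof (rule equalityI; rule factor_closure_subsetI)
    fix u assume "u \<in> range (\<lambda>n. map x [0..<n])"
    then obtain l where u: "u = map x [0..<l]"
      by blast
    obtain n m where n: "l \<le> length ((word_image f ^^ n) [x 0])"
      and m: "(word_image f ^^ n) [x 0] = map x [0..<m]"
      using growth iterate by blast
    then have "prefix u ((word_image f ^^ n) [x 0])"
      unfolding u m by (intro prefix_map_upt) simp
    then show "\<exists>v\<in>range (\<lambda>n. (word_image f ^^ n) [x 0]). sublist u v"
      by blast
  next
    fix u assume "u \<in> range (\<lambda>n. (word_image f ^^ n) [x 0])"
    then obtain m where "u = map x [0..<m]"
      using iterate by blast
    then show "\<exists>v\<in>range (\<lambda>n. map x [0..<n]). sublist u v"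
      by auto
  qed
qed

lemma bi_factors_conv_nth:
  "v \<in> bi_factors w \<longleftrightarrow> (\<exists>i. \<forall>l<length v. v ! l = w (i + int l))"
proof
  assume "\<exists>i. \<forall>l<length v. v ! l = w (i + int l)"
  then obtain i where "\<forall>l<length v. v ! l = w (i + int l)"
    by blast
  then have "v = map w [i..i + int (length v) - 1]"
    by (intro nth_equalityI) simp_all
  then show "v \<in> bi_factors w"
    unfolding bi_factors_def by blast
next
  assume "v \<in> bi_factors w"
  then obtain i j where v: "v = map w [i..j]"
    by (auto simp: bi_factors_def)
  then have "v ! l = w (i + int l)" if "l < length v" for l
    using that by simp
  then show "\<exists>i. \<forall>l<length v. v ! l = w (i + int l)"
    by blast
qed

section \<open>Factorial languages and decoding\<close>

locale factor_language =
  fixes L :: "'a list set"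
  assumes factor: "u \<in> L \<Longrightarrow> sublist v u \<Longrightarrow> v \<in> L"
    and Nil_in: "[] \<in> L"
    and extend: "u \<in> L \<Longrightarrow> \<exists>a b. a # u @ [b] \<in> L"
begin

lemma infix_in: "p @ u @ q \<in> L \<Longrightarrow> u \<in> L"
  using factor by blast

lemma prefix_in: "u @ q \<in> L \<Longrightarrow> u \<in> L"
  using factor by blast

lemma suffix_in: "p @ u \<in> L \<Longrightarrow> u \<in> L"
  using factor by blast

lemma extend_length:
  assumes "u \<in> L"
  shows "\<exists>p q. length p = n \<and> length q = n \<and> p @ u @ q \<in> L"
proof (induction n)
  case 0
  show ?case using assms by simp
next
  case (Suc n)
  then obtain p q where pq: "length p = n" "length q = n" "p @ u @ q \<in> L"
    by blast
  then obtain a b where "a # (p @ u @ q) @ [b] \<in> L"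
    using extend by blast
  then show ?case
    using pq by (intro exI[of _ "a # p"] exI[of _ "q @ [b]"]) simp
qed

lemma factor_closure_eq: "factor_closure L = L"
  using factor unfolding factor_closure_def by blast

end

lemma factor_language_bi_factors: "factor_language (bi_factors w)"
proof
  show "[] \<in> bi_factors w"
    by (simp add: bi_factors_conv_nth)
next
  fix u v
  assume "u \<in> bi_factors w" "sublist v u"
  then obtain i p q where i: "\<forall>l<length u. u ! l = w (i + int l)" and u: "u = p @ v @ q"
    by (auto simp: bi_factors_conv_nth sublist_def)
  have "v ! l = w (i + int (length p) + int l)" if "l < length v" for l
    using that i[rule_format, of "length p + l"] by (simp add: u nth_append add.assoc)
  then show "v \<in> bi_factors w"
    unfolding bi_factors_conv_nth by blast
next
  fix u
  assume "u \<in> bi_factors w"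
  then obtain i where i: "\<forall>l<length u. u ! l = w (i + int l)"
    by (auto simp: bi_factors_conv_nth)
  let ?u = "w (i - 1) # u @ [w (i + int (length u))]"
  have "?u ! l = w (i - 1 + int l)" if "l < length ?u" for l
    using that i by (cases l) (auto simp: nth_append less_Suc_eq algebra_simps)
  then have "?u \<in> bi_factors w"
    unfolding bi_factors_conv_nth by blast
  then show "\<exists>a b. a # u @ [b] \<in> bi_factors w"
    by blast
qed

definition marked :: "'a list set \<Rightarrow> 'a list \<Rightarrow> bool" where
  "marked M t \<longleftrightarrow> (\<exists>m\<in>M. prefix m t)"

lemma marked_append: "marked M t \<Longrightarrow> marked M (t @ q)"
  unfolding marked_def by (meson prefix_prefix)

lemma marked_singleton: "marked {[c]} t \<longleftrightarrow> t \<noteq> [] \<and> hd t = c"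
  by (cases t) (auto simp: marked_def)

text \<open>
  \<open>M\<close> consists of markers, words that occur in \<open>L\<close> only at block boundaries, so that the part of a
  word of \<open>L\<close> from one marker up to another is a concatenation of blocks \<open>f a\<close>.
\<close>

locale decodable_language = factor_language L for L :: "'b list set" +
  fixes f :: "'a \<Rightarrow> 'b list" and A :: "'a set" and M :: "'b list set" and N :: nat
  assumes nonerasing: "a \<in> A \<Longrightarrow> f a \<noteq> []"
    and marker_recurs: "u \<in> L \<Longrightarrow> length u = N \<Longrightarrow> \<exists>p t. u = p @ t \<and> marked M t"
    and image_marked: "a \<in> A \<Longrightarrow> f a @ t \<in> L \<Longrightarrow> marked M t \<Longrightarrow> marked M (f a @ t)"
    and parse_block: "s \<noteq> [] \<Longrightarrow> s @ t \<in> L \<Longrightarrow> marked M (s @ t) \<Longrightarrow> marked M t \<Longrightarrow>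
      \<exists>a\<in>A. \<exists>s'. s = f a @ s' \<and> marked M (s' @ t)"
begin

definition decoded :: "'a list set" where
  "decoded = {u. set u \<subseteq> A \<and> (\<exists>t. word_image f u @ t \<in> L \<and> marked M t)}"

lemma decoded_letters: "u \<in> decoded \<Longrightarrow> set u \<subseteq> A"
  by (simp add: decoded_def)

lemma decoded_image: "u \<in> decoded \<Longrightarrow> word_image f u \<in> L"
  using prefix_in by (auto simp: decoded_def)

lemma word_image_marked:
  "set u \<subseteq> A \<Longrightarrow> word_image f u @ t \<in> L \<Longrightarrow> marked M t \<Longrightarrow> marked M (word_image f u @ t)"
proof (induction u)
  case (Cons a u)
  then show ?case
    using image_marked[of a "word_image f u @ t"] suffix_in[of "f a"] by simp
qed simp

lemma parse:
  "s @ t \<in> L \<Longrightarrow> marked M (s @ t) \<Longrightarrow> marked M t \<Longrightarrow> \<exists>y. set y \<subseteq> A \<and> s = word_image f y"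
proof (induction s rule: measure_induct_rule[of length])
  case (less s)
  show ?case
  proof (cases "s = []")
    case True
    then show ?thesis
      by (intro exI[of _ "[]"]) simp
  next
    case False
    then obtain a s' where s: "a \<in> A" "s = f a @ s'" "marked M (s' @ t)"
      using parse_block less.prems by blast
    have "length s' < length s" "s' @ t \<in> L"
      using s nonerasing[of a] less.prems(1) suffix_in[of "f a" "s' @ t"] by simp_all
    then obtain y where "set y \<subseteq> A" "s' = word_image f y"
      using less.IH less.prems(3) s(3) by blast
    then show ?thesis
      using s by (intro exI[of _ "a # y"]) simp
  qed
qed

lemma extend_to_markers:
  assumes "u \<in> L"
  shows "\<exists>p q t. p \<noteq> [] \<and> q \<noteq> [] \<and> p @ u @ q @ t \<in> L \<and> marked M (p @ u @ q @ t) \<and> marked M t"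
proof -
  obtain a b where "a # u @ [b] \<in> L"
    using extend[OF assms] by blast
  then obtain p q where pq: "length p = N" "length q = N" "p @ (a # u @ [b]) @ q \<in> L"
    using extend_length by blast
  then have "p \<in> L" "q \<in> L"
    using prefix_in[of p] suffix_in[of "p @ a # u @ [b]" q] by simp_all
  then obtain p1 p2 q1 t where p: "p = p1 @ p2" "marked M p2" and q: "q = q1 @ t" "marked M t"
    using marker_recurs pq by metis
  then have "(p2 @ [a]) @ u @ (b # q1) @ t \<in> L"
    using pq(3) suffix_in[of p1] by simp
  moreover have "marked M ((p2 @ [a]) @ u @ (b # q1) @ t)"
    using marked_append[OF p(2)] by simp
  ultimately show ?thesis
    using q(2) by blast
qed

lemma decoded_cover:
  assumes "v \<in> L"
  shows "\<exists>u\<in>decoded. sublist v (word_image f u)"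
proof -
  obtain p q t where t: "(p @ v @ q) @ t \<in> L" "marked M ((p @ v @ q) @ t)" "marked M t"
    using extend_to_markers[OF assms] by auto
  then obtain y where "set y \<subseteq> A" "p @ v @ q = word_image f y"
    using parse by blast
  then show ?thesis
    using t unfolding decoded_def by (metis (mono_tags, lifting) mem_Collect_eq sublist_appendI)
qed

lemma language_eq_closure_decoded: "L = factor_closure (word_image f ` decoded)"
  using decoded_cover decoded_image factor unfolding factor_closure_def by blast

lemma decoded_factor:
  assumes "u \<in> decoded" "sublist v u"
  shows "v \<in> decoded"
proof -
  obtain p q where u: "u = p @ v @ q"
    using assms(2) by (auto simp: sublist_def)
  obtain t where t: "word_image f u @ t \<in> L" "marked M t"
    using assms(1) by (auto simp: decoded_def)
  have image: "word_image f v @ word_image f q @ t \<in> L"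
    using t(1) suffix_in[of "word_image f p"] by (simp add: u)
  moreover have "marked M (word_image f q @ t)"
    using decoded_letters[OF assms(1)] t(2) suffix_in[OF image]
    by (intro word_image_marked) (simp_all add: u)
  ultimately show ?thesis
    using decoded_letters[OF assms(1)] by (auto simp: decoded_def u)
qed

lemma decoded_extend:
  assumes "u \<in> decoded"
  shows "\<exists>a b. a # u @ [b] \<in> decoded"
proof -
  obtain t where t: "word_image f u @ t \<in> L" "marked M t"
    using assms by (auto simp: decoded_def)
  obtain p q t' where nonempty: "p \<noteq> []" "q \<noteq> []" and t': "marked M t'"
    and L: "p @ word_image f u @ t @ q @ t' \<in> L"
    and marked_p: "marked M (p @ word_image f u @ t @ q @ t')"
    using extend_to_markers[OF t(1)] by auto
  have "marked M (word_image f u @ t @ q @ t')"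
    using marked_append[OF word_image_marked[OF decoded_letters[OF assms] t]] by simp
  then obtain y where y: "set y \<subseteq> A" "p = word_image f y"
    using parse[OF L marked_p] by blast
  have "(t @ q) @ t' \<in> L"
    using L suffix_in[of "p @ word_image f u"] by simp
  then obtain z where z: "set z \<subseteq> A" "t @ q = word_image f z"
    using parse marked_append[OF t(2)] t' by (metis append.assoc)
  have "y @ u @ z \<in> decoded"
    using L t' y z decoded_letters[OF assms] unfolding decoded_def
    by (auto simp flip: z(2) intro!: exI[of _ t'])
  moreover obtain y' a b z' where "y = y' @ [a]" "z = b # z'"
    using nonempty y(2) z(2) by (metis append_is_Nil_conv neq_Nil_conv rev_exhaust word_image_Nil)
  ultimately have "a # u @ [b] \<in> decoded"
    using decoded_factor[of _ "a # u @ [b]"] sublist_appendI[of "a # u @ [b]" y' z'] by simp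
  then show ?thesis
    by blast
qed

sublocale decoded: factor_language decoded
proof
  show "[] \<in> decoded"
    using decoded_cover[OF Nil_in] decoded_factor by blast
qed (use decoded_factor decoded_extend in blast)+

lemma decoded_square_free_if_square_free:
  assumes "\<And>v. v \<noteq> [] \<Longrightarrow> v @ v \<notin> L" and "u \<noteq> []"
  shows "u @ u \<notin> decoded"
proof
  assume uu: "u @ u \<in> decoded"
  then have "word_image f u \<noteq> []"
    using assms(2) nonerasing decoded_letters[OF uu] by (cases u) auto
  then show False
    using assms(1) decoded_image[OF uu] by simp
qed

end

context factor_language
begin

lemma parse_block_by_return_words:
  assumes return_words: "\<And>s. c # s @ [c] \<in> L \<Longrightarrow> c \<notin> set s \<Longrightarrow> c # s \<in> f ` A"
    and s: "s \<noteq> []" "s @ t \<in> L" "marked {[c]} (s @ t)" "marked {[c]} t"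
  shows "\<exists>a\<in>A. \<exists>s'. s = f a @ s' \<and> marked {[c]} (s' @ t)"
proof -
  obtain s1 where s1: "s = c # s1"
    using s(1,3) by (cases s) (auto simp: marked_singleton)
  obtain t1 where t1: "t = c # t1"
    using s(4) by (cases t) (auto simp: marked_singleton)
  obtain r s2 where r: "s1 @ [c] = r @ c # s2" "c \<notin> set r"
    using split_list_first[of c "s1 @ [c]"] by auto
  have "c # r @ [c] \<in> L"
    using s(2) r(1) prefix_in[of "c # r @ [c]" "s2 @ t1"]
    by (metis append.assoc append_Cons append_Nil s1 t1)
  then obtain a where a: "a \<in> A" "c # r = f a"
    using return_words r(2) by blast
  obtain s' where "s1 = r @ s'" "s' @ [c] = c # s2"
    using r by (auto simp: append_eq_append_conv2 append_eq_Cons_conv Cons_eq_append_conv)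
  then show ?thesis
    using a t1 by (intro bexI[of _ a] exI[of _ s'])
      (auto simp: s1 marked_singleton append_eq_Cons_conv simp flip: a(2))
qed

lemma decodable_by_return_words:
  assumes images_start: "\<And>a. a \<in> A \<Longrightarrow> f a \<noteq> [] \<and> hd (f a) = c"
    and marker_free_length: "\<And>u. u \<in> L \<Longrightarrow> c \<notin> set u \<Longrightarrow> length u < N"
    and return_words: "\<And>s. c # s @ [c] \<in> L \<Longrightarrow> c \<notin> set s \<Longrightarrow> c # s \<in> f ` A"
  shows "decodable_language L f A {[c]} N"
proof
  show "\<exists>p t. u = p @ t \<and> marked {[c]} t" if u: "u \<in> L" "length u = N" for u
  proof -
    have "c \<in> set u"
      using marker_free_length[OF u(1)] u(2) by blast
    then obtain p t where "u = p @ c # t"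
      by (meson split_list)
    then show ?thesis
      by (intro exI[of _ p] exI[of _ "c # t"]) (simp add: marked_singleton)
  qed
qed (use parse_block_by_return_words[OF return_words] in
    \<open>simp_all add: images_start marked_singleton\<close>)

end

section \<open>Square-free ternary words avoiding 010 and 212\<close>

declare One_nat_def [simp del]

locale square_free_ternary = factor_language L for L :: "nat list set" +
  assumes letters: "u \<in> L \<Longrightarrow> set u \<subseteq> {0, 1, 2}"
    and square_free: "u \<noteq> [] \<Longrightarrow> u @ u \<notin> L"
begin

lemma no_square: "u \<noteq> [] \<Longrightarrow> p @ u @ u @ q \<notin> L"
  using square_free[of u] infix_in[of p "u @ u" q] by auto

lemma distinct_adj_in:
  assumes "u \<in> L"
  shows "distinct_adj u"
  unfolding distinct_adj_conv_nth
proof (intro allI impI)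
  fix i assume "Suc i < length u"
  then have "u = take i u @ [u ! i] @ [u ! Suc i] @ drop (Suc (Suc i)) u"
    by (simp add: Cons_nth_drop_Suc)
  then show "u ! i \<noteq> u ! Suc i"
    using assms no_square[of "[u ! i]"] by (metis not_Cons_self2)
qed

lemma zero_recurs:
  assumes "u \<in> L" "length u = 4"
  shows "0 \<in> set u"
proof (rule ccontr)
  assume no_zero: "0 \<notin> set u"
  obtain a b c d where u: "u = [a, b, c, d]"
    using assms(2) by (auto simp: numeral_eq_Suc length_Suc_conv)
  have "c = a" "d = b"
    using distinct_adj_in[OF assms(1)] letters[OF assms(1)] no_zero by (auto simp: u)
  then show False
    using assms(1) square_free[of "[a, b]"] by (simp add: u)
qed

lemma extend_212:
  assumes "[2, 1, 2] \<in> L"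
  shows "[0, 2, 1, 2, 0] \<in> L"
proof -
  obtain a b where ab: "[a, 2, 1, 2, b] \<in> L"
    using extend[OF assms] by auto
  have "a \<noteq> 2" "b \<noteq> 2"
    using distinct_adj_in[OF ab] by simp_all
  moreover have "a \<noteq> 1" "b \<noteq> 1"
    using ab no_square[of "[1, 2]" "[]" "[b]"] no_square[of "[2, 1]" "[a]" "[]"] by auto
  ultimately show ?thesis
    using ab letters[OF ab] by auto
qed

lemma short_factor_in_hall_thue_cube:
  assumes "u \<in> L" "length u \<le> 2"
  shows "sublist u ((word_image hall_thue ^^ 3) [0])"
proof -
  have cube: "(word_image hall_thue ^^ 3) [0] = [0, 1, 2, 0, 2, 1, 0, 1, 2, 1, 0, 2]"
    by (simp add: numeral_eq_Suc hall_thue_def One_nat_def)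
  consider "u = []" | a where "u = [a]" | a b where "u = [a, b]" "a \<noteq> b"
    using distinct_adj_in[OF assms(1)] assms(2)
    by (auto simp: le_Suc_eq numeral_eq_Suc length_Suc_conv)
  then show ?thesis
    using letters[OF assms(1)] by cases (auto simp: cube sublist_code)
qed

end

locale thue_language = square_free_ternary +
  assumes avoids_010: "[0, 1, 0] \<notin> L"
    and avoids_212: "[2, 1, 2] \<notin> L"

lemma (in square_free_ternary) thue_languageI:
  assumes "[0, 1, 0] \<notin> L" "[0, 2, 1, 2, 0] \<notin> L"
  shows "thue_language L"
  by unfold_locales (use assms extend_212 in blast)+

context thue_language
begin

lemma no_010: "p @ [0, 1, 0] @ q \<notin> L"
  using avoids_010 infix_in by blast

lemma no_212: "p @ [2, 1, 2] @ q \<notin> L"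
  using avoids_212 infix_in by blast

text \<open>
  In the image under \<open>h\<close>, the boundaries of the blocks \<open>012\<close>, \<open>02\<close> and \<open>1\<close> are exactly the
  positions before a \<open>0\<close> and the positions before \<open>10\<close>.
\<close>

abbreviation boundary :: "nat list \<Rightarrow> bool" where
  "boundary \<equiv> marked {[0], [1, 0]}"

lemma boundary_simps:
  "\<not> boundary []"
  "boundary (a # t) \<longleftrightarrow> a = 0 \<or> a = 1 \<and> t \<noteq> [] \<and> hd t = 0"
  by (cases t; auto simp: marked_def)+

lemma boundary_after_2:
  assumes "2 # s @ t \<in> L" "boundary t"
  shows "boundary (s @ t)"
proof (cases "s @ t")
  case Nil
  then show ?thesis
    using assms(2) by (simp add: boundary_simps)
next
  case (Cons a r)
  then have L: "2 # a # r \<in> L"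
    using assms(1) by simp
  show ?thesis
  proof (cases "a = 1")
    case True
    then have "r \<noteq> []"
      using Cons assms(2) by (cases s) (auto simp: boundary_simps)
    then obtain b r' where r: "r = b # r'"
      by (cases r) auto
    have "b \<noteq> 1" "b \<noteq> 2"
      using distinct_adj_in[OF L] no_212[of "[]" r'] L by (auto simp: r True)
    then show ?thesis
      using letters[OF L] by (simp add: Cons r True boundary_simps)
  next
    case False
    then show ?thesis
      using distinct_adj_in[OF L] letters[OF L] by (auto simp: Cons boundary_simps)
  qed
qed

lemma starts_2_or_12_after_0:
  assumes "0 # r @ t \<in> L" "boundary t"
  shows "\<exists>r'. r = 2 # r' \<or> r = 1 # 2 # r'"
proof -
  have adj: "distinct_adj (0 # r @ t)" and letters_r: "set r \<subseteq> {0, 1, 2}"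
    using distinct_adj_in[OF assms(1)] letters[OF assms(1)] by simp_all
  obtain b t' where t: "t = b # t'" "b = 0 \<or> b = 1 \<and> t' \<noteq> [] \<and> hd t' = 0"
    using assms(2) by (cases t) (auto simp: boundary_simps)
  have no_10: "\<nexists>q. r @ t = 1 # 0 # q"
    using assms(1) no_010[of "[]"] by auto
  have "r \<noteq> []" "r \<noteq> [1]"
    by (rule notI; use t adj no_10 in \<open>auto simp: neq_Nil_conv\<close>)+
  then obtain c r' where r: "r = c # r'" "c = 2 \<or> c = 1 \<and> r' \<noteq> []"
    using adj letters_r by (cases r) auto
  then show ?thesis
    using adj letters_r no_10 by (cases r') auto
qed

lemma parse_hall_thue_block:
  assumes "s \<noteq> []" "s @ t \<in> L" "boundary (s @ t)" "boundary t"
  shows "\<exists>a\<in>{0, 1, 2}. \<exists>s'. s = hall_thue a @ s' \<and> boundary (s' @ t)"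
proof -
  obtain a r where s: "s = a # r"
    using assms(1) by (cases s) auto
  show ?thesis
  proof (cases "a = 1")
    case True
    then have "boundary (r @ t)"
      using assms(3) by (cases "r @ t") (auto simp: s boundary_simps)
    then show ?thesis
      by (intro bexI[of _ 2] exI[of _ r]) (simp_all add: s True hall_thue_def)
  next
    case False
    then have "a = 0"
      using assms(3) by (simp add: s boundary_simps)
    then have L: "0 # r @ t \<in> L"
      using assms(2) by (simp add: s)
    consider (image_of_1) r' where "r = 2 # r'" | (image_of_0) r' where "r = 1 # 2 # r'"
      using starts_2_or_12_after_0[OF L assms(4)] by blast
    then show ?thesis
    proof cases
      case image_of_1
      then have "boundary (r' @ t)"
        using L suffix_in[of "[0]"] assms(4) by (intro boundary_after_2) simp_all
      then show ?thesis
        by (intro bexI[of _ 1] exI[of _ r']) (simp_all add: s \<open>a = 0\<close> image_of_1 hall_thue_def)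
    next
      case image_of_0
      then have "boundary (r' @ t)"
        using L suffix_in[of "[0, 1]"] assms(4) by (intro boundary_after_2) simp_all
      then show ?thesis
        by (intro bexI[of _ 0] exI[of _ r']) (simp_all add: s \<open>a = 0\<close> image_of_0 hall_thue_def)
    qed
  qed
qed

sublocale decodable_language L hall_thue "{0, 1, 2}" "{[0], [1, 0]}" 4
proof
  show "\<exists>p t. u = p @ t \<and> boundary t" if u: "u \<in> L" "length u = 4" for u
  proof -
    obtain p t where "u = p @ 0 # t"
      using zero_recurs[OF u] by (meson split_list)
    then show ?thesis
      by (intro exI[of _ p] exI[of _ "0 # t"]) (simp add: boundary_simps)
  qed
  show "boundary (hall_thue a @ t)"
    if "a \<in> {0, 1, 2}" "hall_thue a @ t \<in> L" "boundary t" for a t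
    using that(1,3) distinct_adj_in[OF that(2)]
    by (cases t) (auto simp: hall_thue_def boundary_simps)
qed (use hall_thue_nonempty parse_hall_thue_block in blast)+

lemma thue_language_decoded: "thue_language decoded"
proof -
  interpret decoded: square_free_ternary decoded
    by unfold_locales (use decoded_letters decoded_square_free_if_square_free square_free in blast)+
  show ?thesis
  proof (rule decoded.thue_languageI)
    show "[0, 1, 0] \<notin> decoded"
      using decoded_image[of "[0, 1, 0]"] no_square[of "[2, 0]" "[0, 1]" "[1, 2]"]
      by (auto simp: hall_thue_def)
    show "[0, 2, 1, 2, 0] \<notin> decoded"
      using decoded_image[of "[0, 2, 1, 2, 0]"] no_square[of "[2, 1, 0]" "[0, 1]" "[1, 2]"]
      by (auto simp: hall_thue_def)
  qed
qed

lemma singleton_0_in: "[0] \<in> L"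
proof -
  obtain u where "u \<in> L" "length u = 4"
    using extend_length[OF Nil_in, of 4] prefix_in by auto
  then obtain p q where "p @ [0] @ q \<in> L"
    using zero_recurs[of u] by (metis append_Cons append_Nil split_list)
  then show ?thesis
    by (rule infix_in)
qed

end

section \<open>Uniqueness of the Thue language\<close>

lemma set_word_image_hall_thue: "set (word_image hall_thue u) \<subseteq> {0, 1, 2}"
  by (auto simp: word_image_def hall_thue_def split: if_splits)

lemma length_hall_thue_square:
  "set u \<subseteq> {0, 1, 2} \<Longrightarrow>
     2 * length u \<le> length (word_image hall_thue (word_image hall_thue u))"
  by (induction u) (auto simp: hall_thue_def)

lemma length_funpow_hall_thue:
  assumes "set u \<subseteq> {0, 1, 2}" "u \<noteq> []"
  shows "n < length ((word_image hall_thue ^^ (2 * n)) u)"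
proof (induction n)
  case (Suc n)
  have "set ((word_image hall_thue ^^ (2 * n)) u) \<subseteq> {0, 1, 2}"
    using assms(1) set_word_image_hall_thue by (cases "2 * n") auto
  from length_hall_thue_square[OF this] show ?case
    using Suc by simp
qed (use assms in simp)

lemma factors_b3: "factors b3 = factor_closure (range (\<lambda>n. (word_image hall_thue ^^ n) [0]))"
proof -
  have "hall_thue (b3 i) \<noteq> []" for i
    using b3_range hall_thue_nonempty by blast
  moreover have "\<exists>n. l \<le> length ((word_image hall_thue ^^ n) [b3 0])" for l
    using length_funpow_hall_thue[of "[0]" l] by (auto simp: b3_0 intro: less_imp_le)
  ultimately show ?thesis
    using factors_fixed_point[of hall_thue b3] by (simp add: b3_fixed_point b3_0)
qed

lemma thue_language_desubstitute:
  assumes "thue_language L"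
  shows "\<exists>M. thue_language M \<and> L = factor_closure ((word_image hall_thue ^^ n) ` M)"
proof (induction n)
  case 0
  interpret thue_language L by fact
  show ?case
    using assms factor_closure_eq by (intro exI[of _ L]) simp
next
  case (Suc n)
  then obtain M where "thue_language M" and
    L: "L = factor_closure ((word_image hall_thue ^^ n) ` M)"
    by blast
  interpret M: thue_language M by fact
  have "L = factor_closure ((word_image hall_thue ^^ n) ` word_image hall_thue ` M.decoded)"
    unfolding L by (subst M.language_eq_closure_decoded)
      (rule factor_closure_image[OF sublist_funpow_word_image])
  then have "L = factor_closure ((word_image hall_thue ^^ Suc n) ` M.decoded)"
    by (simp add: image_image funpow_swap1)
  then show ?case
    using M.thue_language_decoded by blast
qed

lemma thue_language_subset_factors_b3:
  assumes "thue_language L"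
  shows "L \<subseteq> factors b3"
proof
  fix v assume "v \<in> L"
  define n where "n = 2 * length v"
  obtain M where "thue_language M"
    and L: "L = factor_closure ((word_image hall_thue ^^ n) ` M)"
    using thue_language_desubstitute[OF assms] by blast
  interpret M: thue_language M by fact
  obtain u where u: "u \<in> M" "sublist v ((word_image hall_thue ^^ n) u)"
    using \<open>v \<in> L\<close> unfolding L factor_closure_def by blast
  have "length v \<le> length ((word_image hall_thue ^^ n) [a])" if "a \<in> set u" for a
    using length_funpow_hall_thue[of "[a]" "length v"] M.letters[OF u(1)] that
    unfolding n_def by (intro less_imp_le) auto
  then obtain u' where "length u' \<le> 2" "sublist u' u"
    and v: "sublist v ((word_image hall_thue ^^ n) u')"
    using sublist_funpow_word_image_pair[OF u(2)] by blast
  then have "sublist u' ((word_image hall_thue ^^ 3) [0])"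
    using M.short_factor_in_hall_thue_cube M.factor u(1) by blast
  then have "sublist v ((word_image hall_thue ^^ n) ((word_image hall_thue ^^ 3) [0]))"
    using v sublist_funpow_word_image sublist_order.order.trans by blast
  then have "sublist v ((word_image hall_thue ^^ (n + 3)) [0])"
    by (simp add: funpow_add)
  then show "v \<in> factors b3"
    unfolding factors_b3 factor_closure_def by blast
qed

lemma factors_b3_subset_thue_language:
  assumes "thue_language L"
  shows "factors b3 \<subseteq> L"
proof
  fix v assume "v \<in> factors b3"
  then obtain n where v: "sublist v ((word_image hall_thue ^^ n) [0])"
    unfolding factors_b3 factor_closure_def by blast
  obtain M where "thue_language M"
    and L: "L = factor_closure ((word_image hall_thue ^^ n) ` M)"
    using thue_language_desubstitute[OF assms] by blast
  then show "v \<in> L"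
    using v thue_language.singleton_0_in[of M] unfolding L factor_closure_def by blast
qed

theorem thue_language_unique: "thue_language L \<Longrightarrow> L = factors b3"
  by (intro equalityI thue_language_subset_factors_b3 factors_b3_subset_thue_language)

section \<open>Overlap-free walks\<close>

locale overlap_free_language = factor_language L for L :: "'a list set" +
  assumes overlap_free: "(a # u) @ (a # u) @ [a] \<notin> L"
begin

lemma no_overlap: "p @ (a # u) @ (a # u) @ [a] @ q \<notin> L"
  using overlap_free[of a u] infix_in[of p "(a # u) @ (a # u) @ [a]" q] by auto

end

locale overlap_free_coding = overlap_free_language L for L :: "nat list set" +
  fixes k :: "nat \<Rightarrow> nat list" and r :: "nat list" and N :: nat
  assumes k_images: "k 0 = 1 # 2 # r @ [2]" "k 1 = [1, 2]" "k 2 = [1, 0]"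
    and one_free_length: "u \<in> L \<Longrightarrow> 1 \<notin> set u \<Longrightarrow> length u < N"
    and one_return_words: "1 # s @ [1] \<in> L \<Longrightarrow> 1 \<notin> set s \<Longrightarrow> 1 # s \<in> k ` {0, 1, 2}"
begin

lemma image_starts_with_1: "a \<in> {0, 1, 2} \<Longrightarrow> k a \<noteq> [] \<and> hd (k a) = 1"
  using k_images by auto

sublocale decodable_language L k "{0, 1, 2}" "{[1]}" N
  by (rule decodable_by_return_words[OF image_starts_with_1 one_free_length one_return_words])

lemma decoded_square_free:
  assumes "u \<noteq> []"
  shows "u @ u \<notin> decoded"
proof
  assume uu: "u @ u \<in> decoded"
  then obtain t where t: "word_image k (u @ u) @ t \<in> L" "marked {[1]} t"
    by (auto simp: decoded_def)
  obtain a u' where "u = a # u'" "a \<in> {0, 1, 2}"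
    using assms decoded_letters[OF uu] by (cases u) auto
  then obtain v where "word_image k u = 1 # v"
    using image_starts_with_1[of a] by (cases "k a") auto
  moreover obtain t' where "t = 1 # t'"
    using t(2) by (cases t) (auto simp: marked_singleton)
  ultimately show False
    using t(1) no_overlap[of "[]" 1 v t'] by simp
qed

lemma thue_language_decoded: "thue_language decoded"
proof -
  interpret decoded: square_free_ternary decoded
    by unfold_locales (use decoded_letters decoded_square_free in blast)+
  show ?thesis
  proof (rule decoded.thue_languageI)
    show "[0, 1, 0] \<notin> decoded"
      using decoded_image[of "[0, 1, 0]"] no_overlap[of "1 # 2 # r" 2 "[1]" "r @ [2]"]
      by (auto simp: k_images)
    show "[0, 2, 1, 2, 0] \<notin> decoded"
      using decoded_image[of "[0, 2, 1, 2, 0]"]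
        no_overlap[of "1 # 2 # r" 2 "[1, 0, 1]" "r @ [2]"]
      by (auto simp: k_images)
  qed
qed

theorem language_eq_factors_image_b3: "L = factors (inf_image k b3)"
proof -
  have "b3 i \<in> {0, 1, 2}" for i
    using b3_range by blast
  then have "k (b3 i) \<noteq> []" for i
    using image_starts_with_1 by blast
  then show ?thesis
    using language_eq_closure_decoded thue_language_unique[OF thue_language_decoded]
    by (simp add: factors_inf_image)
qed

end

definition walk :: "'a set \<Rightarrow> 'a set set \<Rightarrow> 'a list \<Rightarrow> bool" where
  "walk V E u \<longleftrightarrow> set u \<subseteq> V \<and> successively (\<lambda>a b. {a, b} \<in> E) u"

lemma bi_walk_factor:
  assumes "bi_walk V E w" "u \<in> bi_factors w"
  shows "walk V E u"
proof -
  obtain i where "\<forall>l<length u. u ! l = w (i + int l)"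
    using assms(2) by (auto simp: bi_factors_conv_nth)
  moreover have "{w (i + int l), w (i + int (Suc l))} \<in> E" for l
    using assms(1) by (simp add: bi_walk_def add.assoc[symmetric] add.commute[of 1])
  ultimately show ?thesis
    using assms(1) by (auto simp: walk_def bi_walk_def in_set_conv_nth successively_conv_nth)
qed

locale overlap_free_walks = overlap_free_language L for L :: "'a list set" +
  fixes V :: "'a set" and E :: "'a set set"
  assumes walk: "u \<in> L \<Longrightarrow> walk V E u"

lemma is_overlapI: "is_overlap ((a # u) @ (a # u) @ [a])"
  unfolding is_overlap_def
  by (rule exI[of _ "a # u"], rule exI[of _ 2], rule exI[of _ "[a]"])
    (simp add: numeral_eq_Suc field_simps)

lemma overlap_free_walks_bi_factors:
  assumes "bi_walk V E w" "bi_overlap_free w"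
  shows "overlap_free_walks (bi_factors w) V E"
proof -
  interpret factor_language "bi_factors w"
    by (rule factor_language_bi_factors)
  show ?thesis
  proof
    show "(a # u) @ (a # u) @ [a] \<notin> bi_factors w" for a u
      using assms(2) is_overlapI unfolding bi_overlap_free_def by metis
  qed (rule bi_walk_factor[OF assms(1)])
qed

locale P4_walks = overlap_free_walks L P4_verts P4_edges for L
begin

lemma one_free_words:
  "u \<in> L \<Longrightarrow> 1 \<notin> set u \<Longrightarrow>
     u \<in> {[], [0], [2], [3], [2, 3], [3, 2], [2, 3, 2], [3, 2, 3], [2, 3, 2, 3], [3, 2, 3, 2]}"
proof (induction u)
  case (Cons a u)
  have walk_Cons: "walk P4_verts P4_edges (a # u)"
    by (rule walk[OF Cons.prems(1)])
  then have letter: "a \<in> {0, 2, 3}"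
    using Cons.prems(2) by (auto simp: walk_def P4_verts_def)
  have no_alternation: "a # u \<notin> {[2, 3, 2, 3, 2], [3, 2, 3, 2, 3]}"
    using Cons.prems(1) no_overlap[of "[]" 2 "[3]" "[]"] no_overlap[of "[]" 3 "[2]" "[]"] by auto
  have "u \<in> L" "1 \<notin> set u"
    using Cons.prems suffix_in[of "[a]" u] by simp_all
  from letter Cons.IH[OF this] walk_Cons no_alternation show ?case
    by (elim insertE; simp add: walk_def P4_edges_def doubleton_eq_iff)
qed simp

sublocale overlap_free_coding L k4 "[3]" 5
proof
  show "length u < 5" if "u \<in> L" "1 \<notin> set u" for u
    using one_free_words[OF that] by auto
  show "1 # s \<in> k4 ` {0, 1, 2}" if "1 # s @ [1] \<in> L" "1 \<notin> set s" for s
  proof -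
    have "s \<in> {[2, 3, 2], [2], [0]}"
      using one_free_words[of s] walk[OF that(1)] that infix_in[of "[1]" s "[1]"]
      by (auto simp: walk_def P4_edges_def doubleton_eq_iff)
    then show ?thesis
      by (auto simp: k4_def)
  qed
qed (simp_all add: k4_def)

end

locale P3_star_walks = overlap_free_walks L P3_star_verts P3_star_edges for L
begin

lemma one_free_words: "u \<in> L \<Longrightarrow> 1 \<notin> set u \<Longrightarrow> u \<in> {[], [0], [2], [2, 2]}"
proof (induction u)
  case (Cons a u)
  then show ?case
    using walk[OF Cons.prems(1)] suffix_in[of "[a]" u] no_overlap[of "[]" 2 "[]" "[]"]
    by (auto simp: walk_def P3_star_verts_def P3_star_edges_def doubleton_eq_iff)
qed simp

sublocale overlap_free_coding L k3 "[]" 3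
proof
  show "length u < 3" if "u \<in> L" "1 \<notin> set u" for u
    using one_free_words[OF that] by auto
  show "1 # s \<in> k3 ` {0, 1, 2}" if "1 # s @ [1] \<in> L" "1 \<notin> set s" for s
  proof -
    have "s \<in> {[2, 2], [2], [0]}"
      using one_free_words[of s] walk[OF that(1)] that infix_in[of "[1]" s "[1]"]
      by (auto simp: walk_def P3_star_edges_def doubleton_eq_iff)
    then show ?thesis
      by (auto simp: k3_def)
  qed
qed (simp_all add: k3_def)

end

theorem theorem7:
  shows "(\<forall>w. bi_walk P4_verts P4_edges w \<and> bi_overlap_free w \<longrightarrow>
            bi_factors w = factors (inf_image k4 b3)) \<and>
         (\<forall>w. bi_walk P3_star_verts P3_star_edges w \<and> bi_overlap_free w \<longrightarrow>
            bi_factors w = factors (inf_image k3 b3))"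
proof (intro conjI allI impI; elim conjE)
  fix w :: "int \<Rightarrow> nat"
  assume "bi_overlap_free w"
  note walks = overlap_free_walks_bi_factors[OF _ this]
  show "bi_factors w = factors (inf_image k4 b3)" if "bi_walk P4_verts P4_edges w"
  proof -
    interpret P4_walks "bi_factors w"
      using walks[OF that] by (rule P4_walks.intro)
    show ?thesis
      by (rule language_eq_factors_image_b3)
  qed
  show "bi_factors w = factors (inf_image k3 b3)" if "bi_walk P3_star_verts P3_star_edges w"
  proof -
    interpret P3_star_walks "bi_factors w"
      using walks[OF that] by (rule P3_star_walks.intro)
    show ?thesis
      by (rule language_eq_factors_image_b3)
  qed
qed

end
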